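(* Let $C_{1,2d}(\Gamma)=\{p\in C_{1,2d} : p(s)=0\text{ for all } s\in\Gamma\}$. (1) For $\Gamma=\{1,-1\}$ (so $|\Gamma|=2$), $\dim(C_{1,2d}(\Gamma))=d-1$ if $d\ge 2$. (2) For $\Gamma=\{1\}$ (so $|\Gamma|=1$), $\dim(C_{1,2d}(\Gamma))=2d-1$.
   Context: $\mathbb{N}=\{0,1,2,\dots\}$; $d\ge 1$. A univariate circuit polynomial is either a single-exponent polynomial $f(x)=(f_{\alpha(0)}+f_\beta)x^{\alpha(0)}$ with $\beta=\alpha(0)\in 2\mathbb{N}$, $f_{\alpha(0)}>0$, $f_\beta\in\mathbb{R}$ (when nonnegative, a monomial square), or a polynomial $f(x)=f_{\alpha(0)}x^{\alpha(0)}+f_{\alpha(1)}x^{\alpha(1)}+f_\beta x^\beta$ with $\alpha(0)<\beta<\alpha(1)$ in $\mathbb{N}$, $\alpha(0),\alpha(1)$ even, $f_{\alpha(0)},f_{\alpha(1)}>0$ and $f_\beta\in\mathbb{R}$. $C_{1,2d}$ is the cone of all finite sums $\sum_i\mu_i f_i$ of degree at most $2d$ with $\mu_i\ge 0$ and $f_i$ nonnegative univariate circuit polynomials. $\dim$ of a face means the dimension of its affine hull. *)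

theory Defs
  imports "HOL-Analysis.Analysis" "HOL-Computational_Algebra.Polynomial"
begin

text \<open>Polynomials over a real vector space form a real vector space under the
  coefficientwise operations; on \<^typ>\<open>real poly\<close> the scaling is \<^term>\<open>smult\<close>.\<close>

instantiation poly :: (real_vector) real_vector
begin

definition scaleR_poly :: "real \<Rightarrow> 'a poly \<Rightarrow> 'a poly"
  where "scaleR_poly c p = map_poly (scaleR c) p"

instance
  by standard
    (simp_all add: scaleR_poly_def poly_eq_iff coeff_map_poly scaleR_add_right scaleR_add_left)

end

lemma scaleR_poly_eq_smult: "c *\<^sub>R p = smult c p" for p :: "real poly"
  by (simp add: scaleR_poly_def poly_eq_iff coeff_map_poly)

text \<open>The library's \<^const>\<open>aff_dim\<close> is restricted to Euclidean spaces. The dimension of the affine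
  hull is the linear dimension of its direction space. As usual for \<^const>\<open>dim\<close>, the value
  is meaningful only if that space is finite-dimensional.\<close>

definition affine_hull_dim :: "'a::real_vector set \<Rightarrow> nat"
  where "affine_hull_dim S = dim {x - y | x y. x \<in> affine hull S \<and> y \<in> affine hull S}"

definition circuit_poly :: "real poly \<Rightarrow> bool"
  where "circuit_poly f \<longleftrightarrow>
    (\<exists>a fa fb. even a \<and> fa > 0 \<and> f = monom (fa + fb) a) \<or>
    (\<exists>a0 b a1 f0 fb f1. a0 < b \<and> b < a1 \<and> even a0 \<and> even a1 \<and> f0 > 0 \<and> f1 > 0 \<and>
       f = monom f0 a0 + monom f1 a1 + monom fb b)"

definition nonneg_circuit_poly :: "real poly \<Rightarrow> bool"
  where "nonneg_circuit_poly f \<longleftrightarrow> circuit_poly f \<and> (\<forall>x. poly f x \<ge> 0)"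

text \<open>The parameter is the degree bound, so that \<open>C\<^bsub>1,2d\<^esub>\<close> is \<open>sonc_cone (2 * d)\<close>.\<close>

definition sonc_cone :: "nat \<Rightarrow> real poly set"
  where "sonc_cone m = {p. degree p \<le> m \<and>
    (\<exists>(n::nat) \<mu> f. (\<forall>i<n. \<mu> i \<ge> 0 \<and> nonneg_circuit_poly (f i)) \<and>
       p = (\<Sum>i<n. smult (\<mu> i) (f i)))}"

definition sonc_face :: "nat \<Rightarrow> real set \<Rightarrow> real poly set"
  where "sonc_face m \<Gamma> = {p \<in> sonc_cone m. \<forall>s\<in>\<Gamma>. poly p s = 0}"

end

theory Submission
  imports Defs
begin

text \<open>
  Weighted AM-GM makes \<open>A\<^sub>b = (n - b) + b x\<^sup>n - n x\<^sup>b\<close> (with \<open>n = 2d\<close> and \<open>0 < b < n\<close>) a nonnegative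
  circuit polynomial with a double zero at 1. A nonnegative polynomial of degree at most \<open>n\<close> that
  vanishes at 1 has a double zero there, so it is determined by its inner coefficients and is
  therefore a combination of the \<open>A\<^sub>b\<close>. For \<open>\<Gamma> = {1}\<close> all \<open>A\<^sub>b\<close> lie in the face. For
  \<open>\<Gamma> = {1, -1}\<close> every circuit summand must itself vanish at 1 and at -1, which excludes an odd inner
  exponent, so only the \<open>A\<^sub>b\<close> with even \<open>b\<close> remain.
\<close>

section \<open>Affine hull dimension read off from a basis\<close>

lemma affine_hull_dim_eq_card:
  assumes "0 \<in> S" "independent B" "B \<subseteq> S" "S \<subseteq> span B"
  shows "affine_hull_dim S = card B"
proof -
  have "span S = span B"
    using assms(3,4) by (meson span_mono span_minimal subspace_span subset_antisym)
  \<comment> \<open>As \<open>S\<close> contains 0, its affine hull is a linear subspace, and a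
    subspace is its own direction space.\<close>
  then have hull: "affine hull S = span B"
    using assms(1) by (simp add: affine_hull_span_0 hull_inc)
  have "{x - y | x y. x \<in> span B \<and> y \<in> span B} = span B"
  proof (intro subset_antisym subsetI)
    fix x assume "x \<in> span B"
    then have "x = x - 0 \<and> x \<in> span B \<and> 0 \<in> span B"
      by (simp add: span_zero)
    then show "x \<in> {x - y | x y. x \<in> span B \<and> y \<in> span B}"
      by blast
  qed (auto intro: span_diff)
  with hull assms(2) show ?thesis
    by (simp add: affine_hull_dim_def dim_span dim_eq_card_independent)
qed

section \<open>The AM-GM circuit polynomials and their nonnegativity\<close>

definition agm_poly :: "nat \<Rightarrow> nat \<Rightarrow> real poly"
  where "agm_poly n b = monom (real (n - b)) 0 + monom (real b) n + monom (- real n) b"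

lemma coeff_agm_poly:
  assumes "0 < k" "k < n"
  shows "coeff (agm_poly n b) k = (if k = b then - real n else 0)"
  using assms by (auto simp: agm_poly_def)

lemma poly_agm_poly: "poly (agm_poly n b) x = real (n - b) + real b * x ^ n - real n * x ^ b"
  by (simp add: agm_poly_def poly_monom)

text \<open>With \<open>n = b + m\<close>, the gap between the two sides is the sum of
  \<open>(x - 1) * (x ^ (b + i) - x ^ j)\<close> over \<open>i < m\<close> and \<open>j < b\<close>.
  Each term is nonnegative: since \<open>j < b + i\<close>, its two factors never have opposite
  signs. Geometric sums evaluate the double sum.\<close>

lemma weighted_power_mean_le:
  fixes x :: real
  assumes "0 \<le> x" "b \<le> n"
  shows "real n * x ^ b \<le> real (n - b) + real b * x ^ n"
proof -
  obtain m where n: "n = b + m"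
    using assms(2) le_Suc_ex by blast
  have "0 \<le> (x - 1) * (x ^ (b + i) - x ^ j)" if "j < b" for i j
  proof (cases "x \<le> 1")
    case True
    then have "x ^ (b + i) \<le> x ^ j"
      using assms that by (intro power_decreasing) auto
    with True show ?thesis
      by (simp add: mult_nonpos_nonpos)
  next
    case False
    then have "x ^ j \<le> x ^ (b + i)"
      using that by (intro power_increasing) auto
    with False show ?thesis
      by simp
  qed
  then have "0 \<le> (\<Sum>i<m. \<Sum>j<b. (x - 1) * (x ^ (b + i) - x ^ j))"
    by (intro sum_nonneg) simp
  also have "\<dots> = real b * x ^ b * ((x - 1) * (\<Sum>i<m. x ^ i)) - real m * ((x - 1) * (\<Sum>j<b. x ^ j))"
    by (simp add: right_diff_distrib sum_subtractf sum_distrib_left power_add mult_ac)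
  also have "\<dots> = real b * x ^ b * (x ^ m - 1) - real m * (x ^ b - 1)"
    by (simp add: power_diff_1_eq)
  finally show ?thesis
    by (simp add: n algebra_simps power_add)
qed

lemma nonneg_agm_poly:
  assumes "even n" "b \<le> n"
  shows "0 \<le> poly (agm_poly n b) x"
proof -
  \<comment> \<open>Reduction to a nonnegative argument: passing to \<open>\<bar>x\<bar>\<close> can
    only increase \<open>x ^ b\<close> and, \<open>n\<close> being even, leaves \<open>x ^ n\<close>
    unchanged.\<close>
  have "real n * x ^ b \<le> real n * \<bar>x\<bar> ^ b"
    by (metis abs_ge_self mult_left_mono of_nat_0_le_iff power_abs)
  also have "\<dots> \<le> real (n - b) + real b * \<bar>x\<bar> ^ n"
    using assms by (intro weighted_power_mean_le) auto
  finally show ?thesis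
    using assms(1) by (simp add: poly_agm_poly power_even_abs)
qed

lemma agm_poly_in_sonc_cone:
  assumes "even n" "0 < b" "b < n"
  shows "agm_poly n b \<in> sonc_cone n"
proof -
  have "circuit_poly (agm_poly n b)"
    unfolding circuit_poly_def agm_poly_def using assms
    by (intro disjI2 exI[of _ 0] exI[of _ b] exI[of _ n] exI[of _ "real (n - b)"]
        exI[of _ "- real n"] exI[of _ "real b"]) auto
  then have "nonneg_circuit_poly (agm_poly n b)"
    using assms by (simp add: nonneg_circuit_poly_def nonneg_agm_poly)
  moreover have "agm_poly n b = (\<Sum>i<1::nat. smult 1 (agm_poly n b))"
    by simp
  moreover have "degree (agm_poly n b) \<le> n"
    unfolding agm_poly_def using assms
    by (intro degree_add_le order_trans[OF degree_monom_le]) auto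
  ultimately show ?thesis
    unfolding sonc_cone_def
    by (intro CollectI conjI exI[of _ "1::nat"] exI[of _ "\<lambda>_. 1"] exI[of _ "\<lambda>_. agm_poly n b"]) auto
qed

lemma zero_in_sonc_cone: "0 \<in> sonc_cone n"
  unfolding sonc_cone_def by (auto intro!: exI[of _ "0::nat"])

lemma sonc_cone_nonneg: "p \<in> sonc_cone n \<Longrightarrow> 0 \<le> poly p x"
  by (auto simp: sonc_cone_def nonneg_circuit_poly_def poly_sum intro!: sum_nonneg)

section \<open>Double zeros and spanning\<close>

lemma poly_pderiv_eq_0_if_nonneg:
  fixes p :: "real poly"
  assumes "\<And>x. 0 \<le> poly p x" "poly p a = 0"
  shows "poly (pderiv p) a = 0"
  \<comment> \<open>A zero of a nonnegative polynomial is a global minimum, so the radius 1 is an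
    arbitrary choice.\<close>
  using DERIV_local_min[OF poly_DERIV, of 1 a p] assms by simp

text \<open>Only \<open>a + c x^n\<close> is left. Its derivative at 1 is \<open>n c\<close>, which
  forces \<open>c = 0\<close>; its value at 1 then forces \<open>a = 0\<close>.\<close>

lemma eq_0_if_inner_coeffs_eq_0:
  fixes q :: "real poly"
  assumes "degree q \<le> n" "0 < n" "poly q 1 = 0" "poly (pderiv q) 1 = 0"
    and "\<And>k. 0 < k \<Longrightarrow> k < n \<Longrightarrow> coeff q k = 0"
  shows "q = 0"
proof -
  have "q = monom (coeff q 0) 0 + monom (coeff q n) n"
  proof (rule poly_eqI)
    fix k
    show "coeff q k = coeff (monom (coeff q 0) 0 + monom (coeff q n) n) k"
      using assms(1,2) assms(5)[of k] coeff_eq_0[of q k]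
      by (cases "k = 0"; cases "k < n"; cases "k = n") auto
  qed
  then obtain a c where q: "q = monom a 0 + monom c n"
    by blast
  with assms(2,4) have "c = 0"
    by (simp add: pderiv_add pderiv_monom poly_monom)
  with q assms(3) have "a = 0"
    by (simp add: poly_monom)
  with q \<open>c = 0\<close> show ?thesis
    by simp
qed

lemma pderiv_sum: "pderiv (\<Sum>i\<in>A. f i) = (\<Sum>i\<in>A. pderiv (f i))"
  by (induction A rule: infinite_finite_induct) (auto simp: pderiv_add)

lemma in_span_agm_polys:
  assumes "finite I" "I \<subseteq> {0<..<n}" "0 < n"
    and "degree p \<le> n" "poly p 1 = 0" "poly (pderiv p) 1 = 0"
    and "\<And>k. 0 < k \<Longrightarrow> k < n \<Longrightarrow> k \<notin> I \<Longrightarrow> coeff p k = 0"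
  shows "p \<in> span (agm_poly n ` I)"
proof -
  \<comment> \<open>The coefficient of \<open>x^b\<close> in \<open>agm_poly n b\<close> is
    \<open>- n\<close>, so these scalars make \<open>r\<close> agree with \<open>p\<close> at all
    inner exponents. As \<open>r\<close> also has a double zero at 1, the difference
    \<open>p - r\<close> must vanish.\<close>
  define r where "r = (\<Sum>b\<in>I. smult (- coeff p b / real n) (agm_poly n b))"
  have deg: "degree (agm_poly n b) \<le> n" if "b \<in> I" for b
    unfolding agm_poly_def using assms(2) that
    by (intro degree_add_le order_trans[OF degree_monom_le]) auto
  have "p - r = 0"
  proof (rule eq_0_if_inner_coeffs_eq_0[OF _ assms(3)])
    have "degree r \<le> n"
      unfolding r_def using deg
      by (intro degree_sum_le assms(1) order_trans[OF degree_smult_le]) auto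
    with assms(4) show "degree (p - r) \<le> n"
      by (rule degree_diff_le)
    have "poly (agm_poly n b) 1 = 0" if "b \<in> I" for b
      using assms(2) that by (auto simp: poly_agm_poly of_nat_diff)
    then show "poly (p - r) 1 = 0"
      by (simp add: r_def poly_sum assms(5))
    have "poly (pderiv (agm_poly n b)) 1 = 0" if "b \<in> I" for b
      by (simp add: agm_poly_def pderiv_add pderiv_monom poly_monom)
    then show "poly (pderiv (p - r)) 1 = 0"
      by (simp add: r_def pderiv_diff pderiv_sum pderiv_minus pderiv_smult poly_sum assms(6))
    fix k assume k: "0 < k" "k < n"
    then have "coeff r k = (\<Sum>b\<in>I. if b = k then coeff p b else 0)"
      unfolding r_def coeff_sum by (intro sum.cong) (auto simp: coeff_agm_poly)
    also have "\<dots> = coeff p k"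
      using assms(1,7) k by simp
    finally show "coeff (p - r) k = 0"
      by simp
  qed
  moreover have "r \<in> span (agm_poly n ` I)"
    unfolding r_def scaleR_poly_eq_smult[symmetric]
    by (intro span_sum span_scale span_base imageI)
  ultimately show ?thesis
    by simp
qed

section \<open>Linear independence and the dimension of a face\<close>

lemma inj_on_agm_poly: "inj_on (agm_poly n) {0<..<n}"
proof (rule inj_onI)
  fix a b assume *: "a \<in> {0<..<n}" "b \<in> {0<..<n}" "agm_poly n a = agm_poly n b"
  then have "coeff (agm_poly n a) b = - real n"
    by (simp add: coeff_agm_poly)
  with *(2) show "a = b"
    by (simp add: coeff_agm_poly split: if_splits)
qed

lemma independent_agm_polys:
  assumes "finite I" "I \<subseteq> {0<..<n}"
  shows "independent (agm_poly n ` I)"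
proof (rule independent_if_scalars_zero)
  fix f p assume sum0: "(\<Sum>p\<in>agm_poly n ` I. f p *\<^sub>R p) = 0" and "p \<in> agm_poly n ` I"
  then obtain b where b: "b \<in> I" "p = agm_poly n b"
    by blast
  with assms have bn: "0 < b" "b < n"
    by auto
  \<comment> \<open>Among the \<open>agm_poly n a\<close>, only the one with \<open>a = b\<close>
    has a nonzero coefficient at the inner exponent \<open>b\<close>.\<close>
  have "0 = coeff (\<Sum>a\<in>I. f (agm_poly n a) *\<^sub>R agm_poly n a) b"
    using sum0 by (simp add: sum.reindex inj_on_subset[OF inj_on_agm_poly assms(2)])
  also have "\<dots> = (\<Sum>a\<in>I. if a = b then - real n * f p else 0)"
    unfolding coeff_sum using b(2) bn
    by (intro sum.cong) (auto simp: coeff_agm_poly scaleR_poly_eq_smult)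
  also have "\<dots> = - real n * f p"
    using assms(1) b(1) by simp
  finally show "f p = 0"
    using bn by simp
qed (use assms in simp)

text \<open>Reduces both claims to finding the inner exponents \<open>I\<close> that can occur in
  the face: membership of the \<open>agm_poly n b\<close> bounds the dimension from below, the
  vanishing coefficients outside \<open>I\<close> from above. The point 1 in \<open>\<Gamma>\<close>
  supplies the double zero.\<close>

lemma affine_hull_dim_sonc_face:
  assumes "0 < n" "1 \<in> \<Gamma>" "I \<subseteq> {0<..<n}"
    and "\<And>b. b \<in> I \<Longrightarrow> agm_poly n b \<in> sonc_face n \<Gamma>"
    and "\<And>p k. p \<in> sonc_face n \<Gamma> \<Longrightarrow> 0 < k \<Longrightarrow> k < n \<Longrightarrow> k \<notin> I \<Longrightarrow> coeff p k = 0"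
  shows "affine_hull_dim (sonc_face n \<Gamma>) = card I"
proof -
  have fin: "finite I"
    using assms(3) finite_subset by blast
  have "sonc_face n \<Gamma> \<subseteq> span (agm_poly n ` I)"
  proof
    fix p assume p: "p \<in> sonc_face n \<Gamma>"
    then have *: "p \<in> sonc_cone n" "poly p 1 = 0"
      using assms(2) by (auto simp: sonc_face_def)
    then have "poly (pderiv p) 1 = 0"
      using sonc_cone_nonneg poly_pderiv_eq_0_if_nonneg by blast
    moreover have "degree p \<le> n"
      using *(1) by (simp add: sonc_cone_def)
    ultimately show "p \<in> span (agm_poly n ` I)"
      using assms(1,3,5) p * fin by (intro in_span_agm_polys) auto
  qed
  moreover have "0 \<in> sonc_face n \<Gamma>"
    by (simp add: sonc_face_def zero_in_sonc_cone)
  moreover have "agm_poly n ` I \<subseteq> sonc_face n \<Gamma>"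
    using assms(4) by blast
  ultimately have "affine_hull_dim (sonc_face n \<Gamma>) = card (agm_poly n ` I)"
    using independent_agm_polys[OF fin assms(3)] by (intro affine_hull_dim_eq_card)
  also have "\<dots> = card I"
    by (rule card_image[OF inj_on_subset[OF inj_on_agm_poly assms(3)]])
  finally show ?thesis .
qed

section \<open>Odd coefficients under zeros at both 1 and -1\<close>

lemma circuit_poly_odd_coeff_eq_0:
  assumes "circuit_poly f" "poly f 1 = 0" "poly f (-1) = 0" "odd k"
  shows "coeff f k = 0"
  using assms(1) unfolding circuit_poly_def
proof (elim disjE exE conjE)
  fix a fa fb assume "even a" "f = monom (fa + fb) a"
  with assms(4) show ?thesis
    by auto
next
  fix a0 b a1 f0 fb f1
  assume *: "even a0" "even a1" "f0 > 0" "f1 > 0"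
    and f: "f = monom f0 a0 + monom f1 a1 + monom fb b"
  have "even b"
  proof (rule ccontr)
    \<comment> \<open>Here the values at 1 and -1 are \<open>f0 + f1 + fb\<close> and
      \<open>f0 + f1 - fb\<close>; both being 0 would give \<open>f0 + f1 = 0\<close>.\<close>
    assume "odd b"
    with assms(2,3) * show False
      by (simp add: f poly_monom)
  qed
  with * assms(4) show ?thesis
    by (auto simp: f)
qed

lemma sonc_face_odd_coeff_eq_0:
  assumes "p \<in> sonc_face n {1, -1}" "odd k"
  shows "coeff p k = 0"
proof -
  obtain m :: nat and \<mu> f
    where *: "\<And>i. i < m \<Longrightarrow> \<mu> i \<ge> 0 \<and> nonneg_circuit_poly (f i)"
      and p: "p = (\<Sum>i<m. smult (\<mu> i) (f i))"
    using assms(1) by (auto simp: sonc_face_def sonc_cone_def)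
  \<comment> \<open>A sum of nonnegative terms is zero only if every term is, so the zeros pass to
    each summand of positive weight.\<close>
  have vanish: "\<mu> i * poly (f i) s = 0" if "i < m" "s \<in> {1, -1}" for i s
  proof -
    have "(\<Sum>i<m. \<mu> i * poly (f i) s) = 0"
      using assms(1) that(2) by (auto simp: sonc_face_def p poly_sum)
    moreover have "\<forall>i\<in>{..<m}. 0 \<le> \<mu> i * poly (f i) s"
      using * by (simp add: nonneg_circuit_poly_def)
    ultimately have "\<forall>i\<in>{..<m}. \<mu> i * poly (f i) s = 0"
      by (subst sum_nonneg_eq_0_iff[symmetric]) auto
    with that(1) show ?thesis
      by blast
  qed
  have "\<mu> i * coeff (f i) k = 0" if "i < m" for i
    using vanish[OF that, of 1] vanish[OF that, of "-1"] *[OF that] assms(2)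
      circuit_poly_odd_coeff_eq_0[of "f i" k]
    by (auto simp: nonneg_circuit_poly_def)
  then show ?thesis
    unfolding p coeff_sum coeff_smult by (intro sum.neutral) simp
qed

theorem lemma5p2:
  fixes d :: nat
  assumes "d \<ge> 1"
  shows "(d \<ge> 2 \<longrightarrow> affine_hull_dim (sonc_face (2 * d) {1, -1}) = d - 1) \<and>
         affine_hull_dim (sonc_face (2 * d) {1}) = 2 * d - 1"
proof
  \<comment> \<open>The index set consists of the even numbers strictly between 0 and
    \<open>2 * d\<close>; for even \<open>b\<close>, \<open>agm_poly (2 * d) b\<close> is an even
    function, so its zero at 1 recurs at -1.\<close>
  have "affine_hull_dim (sonc_face (2 * d) {1, -1}) = card ((*) 2 ` {0<..<d})"
  proof (rule affine_hull_dim_sonc_face)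
    fix b assume "b \<in> (*) 2 ` {0<..<d}"
    then show "agm_poly (2 * d) b \<in> sonc_face (2 * d) {1, -1}"
      by (auto simp: sonc_face_def agm_poly_in_sonc_cone poly_agm_poly of_nat_diff)
  next
    fix p k
    assume p: "p \<in> sonc_face (2 * d) {1, -1}"
      and k: "0 < k" "k < 2 * d" "k \<notin> (*) 2 ` {0<..<d}"
    from k have "odd k"
      by (auto elim!: evenE)
    with p show "coeff p k = 0"
      by (rule sonc_face_odd_coeff_eq_0)
  qed (use assms in auto)
  then show "d \<ge> 2 \<longrightarrow> affine_hull_dim (sonc_face (2 * d) {1, -1}) = d - 1"
    by (simp add: card_image inj_on_def)
  \<comment> \<open>With all inner exponents in the index set, the coefficient condition is
    vacuous.\<close>
  have "affine_hull_dim (sonc_face (2 * d) {1}) = card {0<..<2 * d}"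
    by (rule affine_hull_dim_sonc_face)
      (use assms in \<open>auto simp: sonc_face_def agm_poly_in_sonc_cone poly_agm_poly of_nat_diff\<close>)
  then show "affine_hull_dim (sonc_face (2 * d) {1}) = 2 * d - 1"
    by simp
qed

end
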